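(* Let $G$ be a finitely generated group, $K$ a subgroup of $G$ and $\psi:\Sigma\to G$ a semigroup presentation of $G$. Then the language $L(G,K,\psi)=\{w\in\Sigma^*:\psi(w)\in K\}$ is regular if and only if $K$ has finite index in $G$.
   Context: A *semigroup presentation* of a finitely generated group $G$ is a (not necessarily injective) map $\psi:\Sigma\to G$ from a finite alphabet $\Sigma$ such that its extension to a monoid homomorphism $\psi:\Sigma^*\to G$ (where $\Sigma^*$ is the free monoid of words over $\Sigma$) is surjective. $L(G,K,\psi)$ is called the word problem of $(G,K)$ with respect to $\psi$. The subgroup $K$ need not be finitely generated. *)

theory Defs
  imports "HOL-Algebra.Algebra"
begin

record ('q, 'a) dfa =
  states :: "'q set"
  init :: "'q"
  final :: "'q set"
  step :: "'q \<Rightarrow> 'a \<Rightarrow> 'q"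

locale dfa =
  fixes \<Sigma> :: "'a set" and M :: "('q, 'a) dfa"
  assumes finite_states: "finite (states M)"
    and init: "init M \<in> states M"
    and final: "final M \<subseteq> states M"
    and step: "\<lbrakk>q \<in> states M; a \<in> \<Sigma>\<rbrakk> \<Longrightarrow> step M q a \<in> states M"

definition dfa_lang :: "'a set \<Rightarrow> ('q, 'a) dfa \<Rightarrow> 'a list set" where
  "dfa_lang \<Sigma> M = {w \<in> lists \<Sigma>. foldl (step M) (init M) w \<in> final M}"

text \<open>States are taken to be natural numbers because HOL cannot quantify over the state type
  inside a formula; by \<open>regularI\<close> below, automata over any state type give the same notion.\<close>

definition regular :: "'a set \<Rightarrow> 'a list set \<Rightarrow> bool" where
  "regular \<Sigma> L \<longleftrightarrow> (\<exists>M :: (nat, 'a) dfa. dfa \<Sigma> M \<and> dfa_lang \<Sigma> M = L)"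

lemma regularI:
  fixes M :: "('q, 'a) dfa"
  assumes "dfa \<Sigma> M"
  shows "regular \<Sigma> (dfa_lang \<Sigma> M)"
proof -
  interpret dfa \<Sigma> M by fact
  obtain f :: "'q \<Rightarrow> nat" where f: "inj_on f (states M)"
    using finite_imp_inj_to_nat_seg[OF finite_states] by blast
  define g where "g = inv_into (states M) f"
  have gf: "g (f q) = q" if "q \<in> states M" for q
    using f that by (simp add: g_def)
  define N :: "(nat, 'a) dfa" where
    "N = \<lparr>states = f ` states M, init = f (init M), final = f ` final M,
          step = (\<lambda>n a. f (step M (g n) a))\<rparr>"
  have "dfa \<Sigma> N"
    using finite_states init final step by unfold_locales (auto simp: N_def gf)
  moreover have run: "foldl (step N) (f q) w = f (foldl (step M) q w) \<and>
      foldl (step M) q w \<in> states M" if "q \<in> states M" "w \<in> lists \<Sigma>" for q w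
    using that by (induction w arbitrary: q) (auto simp: N_def gf step)
  have "dfa_lang \<Sigma> N = dfa_lang \<Sigma> M"
    unfolding dfa_lang_def
  proof (intro Collect_cong conj_cong refl)
    fix w assume w: "w \<in> lists \<Sigma>"
    have "foldl (step N) (init N) w = f (foldl (step M) (init M) w)"
      "foldl (step M) (init M) w \<in> states M"
      using run[OF init w] by (auto simp: N_def)
    moreover have "final N = f ` final M" by (simp add: N_def)
    ultimately show "foldl (step N) (init N) w \<in> final N \<longleftrightarrow> foldl (step M) (init M) w \<in> final M"
      using inj_on_image_mem_iff[OF f _ final] by simp
  qed
  ultimately show ?thesis
    unfolding regular_def by blast
qed

definition finitely_generated :: "('g, 'm) monoid_scheme \<Rightarrow> bool" where
  "finitely_generated G \<longleftrightarrow> (\<exists>S. finite S \<and> S \<subseteq> carrier G \<and> generate G S = carrier G)"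

definition word_val :: "('g, 'm) monoid_scheme \<Rightarrow> ('a \<Rightarrow> 'g) \<Rightarrow> 'a list \<Rightarrow> 'g" where
  "word_val G \<psi> w = foldr (\<otimes>\<^bsub>G\<^esub>) (map \<psi> w) \<one>\<^bsub>G\<^esub>"

definition semigroup_presentation ::
    "('g, 'm) monoid_scheme \<Rightarrow> 'a set \<Rightarrow> ('a \<Rightarrow> 'g) \<Rightarrow> bool" where
  "semigroup_presentation G \<Sigma> \<psi> \<longleftrightarrow>
     finite \<Sigma> \<and> \<psi> \<in> \<Sigma> \<rightarrow> carrier G \<and> word_val G \<psi> ` lists \<Sigma> = carrier G"

definition word_problem ::
    "('g, 'm) monoid_scheme \<Rightarrow> 'g set \<Rightarrow> 'a set \<Rightarrow> ('a \<Rightarrow> 'g) \<Rightarrow> 'a list set" where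
  "word_problem G K \<Sigma> \<psi> = {w \<in> lists \<Sigma>. word_val G \<psi> w \<in> K}"

definition finite_index :: "('g, 'm) monoid_scheme \<Rightarrow> 'g set \<Rightarrow> bool" where
  "finite_index G K \<longleftrightarrow> finite (rcosets\<^bsub>G\<^esub> K)"

end

theory Submission
  imports Defs
begin

text \<open>Reading \<open>w\<close> moves the coset \<open>K\<close> to \<open>K \<psi>(w)\<close>, so the coset graph of \<open>K\<close>, with \<open>K\<close> as
  initial and only final state, recognises the word problem; it is a finite automaton when the
  index is finite. Conversely, if two words \<open>u\<close> and \<open>v\<close> reach the same state of an automaton for
  the word problem and \<open>v'\<close> represents \<open>\<psi>(v)\<inverse>\<close>, then \<open>v v'\<close>, and hence \<open>u v'\<close>, is accepted, so
  \<open>K \<psi>(u) = K \<psi>(v)\<close>: there are at most as many cosets as states.\<close>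

lemma word_val_Nil [simp]: "word_val G \<psi> [] = \<one>\<^bsub>G\<^esub>"
  by (simp add: word_val_def)

lemma word_val_Cons [simp]: "word_val G \<psi> (a # w) = \<psi> a \<otimes>\<^bsub>G\<^esub> word_val G \<psi> w"
  by (simp add: word_val_def)

lemma (in dfa) foldl_step_closed:
  assumes "q \<in> states M" "w \<in> lists \<Sigma>"
  shows "foldl (step M) q w \<in> states M"
  using assms(2,1) by (induction arbitrary: q) (auto simp: step)

context group
begin

lemma word_val_closed:
  assumes "\<psi> \<in> \<Sigma> \<rightarrow> carrier G" "w \<in> lists \<Sigma>"
  shows "word_val G \<psi> w \<in> carrier G"
  using assms(2,1) by induction auto

lemma word_val_append:
  assumes "\<psi> \<in> \<Sigma> \<rightarrow> carrier G" "u \<in> lists \<Sigma>" "v \<in> lists \<Sigma>"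
  shows "word_val G \<psi> (u @ v) = word_val G \<psi> u \<otimes> word_val G \<psi> v"
  using assms(2,1,3)
proof induction
  case (Cons a u)
  then show ?case
    by (auto simp: m_assoc Pi_iff word_val_closed[of \<psi> \<Sigma>])
qed (simp add: word_val_closed)

text \<open>\<open>foldl\<close> brackets the product to the left and \<open>word_val\<close>, being
  a \<open>foldr\<close>, to the right; associativity of right multiplication on subsets reconciles
  the two. \<open>C\<close> is arbitrary because each letter read replaces it by
  \<open>C #> \<psi> a\<close>.\<close>

lemma foldl_r_coset:
  assumes "\<psi> \<in> \<Sigma> \<rightarrow> carrier G" "C \<subseteq> carrier G" "w \<in> lists \<Sigma>"
  shows "foldl (\<lambda>C a. C #> \<psi> a) C w = C #> word_val G \<psi> w"
  using assms(3,1,2)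
proof (induction arbitrary: C)
  case (Cons a w)
  then have "\<psi> a \<in> carrier G" by auto
  with Cons show ?case
    by (simp add: r_coset_subset_G coset_mult_assoc word_val_closed[of \<psi> \<Sigma>])
qed simp

lemma regular_word_problem_if_finite_index:
  assumes K: "subgroup K G" and \<psi>: "\<psi> \<in> \<Sigma> \<rightarrow> carrier G" and "finite_index G K"
  shows "regular \<Sigma> (word_problem G K \<Sigma> \<psi>)"
proof -
  define M where "M = \<lparr>states = rcosets K, init = K, final = {K}, step = (\<lambda>C a. C #> \<psi> a)\<rparr>"
  have K_sub: "K \<subseteq> carrier G"
    using K by (rule subgroup.subset)
  have "K \<in> rcosets K"
    using K is_group by (rule subgroup.subgroup_in_rcosets)
  moreover have "C #> \<psi> a \<in> rcosets K" if "C \<in> rcosets K" "a \<in> \<Sigma>" for C a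
  proof -
    obtain x where x: "x \<in> carrier G" "C = K #> x"
      using \<open>C \<in> rcosets K\<close> by (auto simp: RCOSETS_def)
    have "\<psi> a \<in> carrier G"
      using \<psi> \<open>a \<in> \<Sigma>\<close> by auto
    then show ?thesis
      using x K_sub by (simp add: coset_mult_assoc rcosetsI)
  qed
  ultimately have "dfa \<Sigma> M"
    using \<open>finite_index G K\<close> by unfold_locales (auto simp: M_def finite_index_def)
  moreover have "dfa_lang \<Sigma> M = word_problem G K \<Sigma> \<psi>"
    unfolding dfa_lang_def word_problem_def
  proof (intro Collect_cong conj_cong refl)
    fix w assume w: "w \<in> lists \<Sigma>"
    \<comment> \<open>The coset reached is the single final state exactly when the value lies in
      \<open>K\<close>.\<close>
    have "K #> word_val G \<psi> w = K \<longleftrightarrow> word_val G \<psi> w \<in> K"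
      using word_val_closed[OF \<psi> w] K by (metis coset_join1 coset_join2 K_sub)
    then show "foldl (step M) (init M) w \<in> final M \<longleftrightarrow> word_val G \<psi> w \<in> K"
      by (simp add: M_def foldl_r_coset[OF \<psi> K_sub w])
  qed
  \<comment> \<open>The states of \<open>M\<close> are cosets, while \<open>regular\<close> asks for
    natural numbers; \<open>regularI\<close> renumbers them.\<close>
  ultimately show ?thesis
    using regularI by metis
qed

lemma finite_index_if_regular_word_problem:
  fixes \<Sigma> :: "'c set"
  assumes K: "subgroup K G" and \<psi>: "\<psi> \<in> \<Sigma> \<rightarrow> carrier G"
    and surj: "word_val G \<psi> ` lists \<Sigma> = carrier G"
    and "regular \<Sigma> (word_problem G K \<Sigma> \<psi>)"
  shows "finite_index G K"
proof -
  obtain M :: "(nat, 'c) dfa" where "dfa \<Sigma> M" and L: "dfa_lang \<Sigma> M = word_problem G K \<Sigma> \<psi>"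
    using \<open>regular _ _\<close> by (auto simp: regular_def)
  then interpret M: dfa \<Sigma> M by simp
  define run where "run w = foldl (step M) (init M) w" for w
  \<comment> \<open>A chosen word leading to \<open>q\<close>; for an unreachable \<open>q\<close>
    the choice is arbitrary, which is harmless because the covering of the cosets below only uses
    states of the form \<open>run w\<close>.\<close>
  define word where "word q = (SOME w. w \<in> lists \<Sigma> \<and> run w = q)" for q
  have coset_eq: "K #> word_val G \<psi> u = K #> word_val G \<psi> v"
    if u: "u \<in> lists \<Sigma>" and v: "v \<in> lists \<Sigma>" and "run u = run v" for u v
  proof -
    note closed = word_val_closed[OF \<psi> u] word_val_closed[OF \<psi> v]
    \<comment> \<open>The alphabet has no formal inverses, so surjectivity on words has to supply
      one.\<close>
    have "inv (word_val G \<psi> v) \<in> word_val G \<psi> ` lists \<Sigma>"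
      using closed surj by simp
    then obtain v' where v': "v' \<in> lists \<Sigma>" "word_val G \<psi> v' = inv (word_val G \<psi> v)"
      by force
    have "v @ v' \<in> word_problem G K \<Sigma> \<psi>"
      using closed u v v' subgroup.one_closed[OF K]
      by (simp add: word_problem_def word_val_append[OF \<psi>])
    \<comment> \<open>From equal states, the common suffix \<open>v'\<close> leads to equal states,
      so acceptance passes from \<open>v @ v'\<close> to \<open>u @ v'\<close>.\<close>
    then have "u @ v' \<in> word_problem G K \<Sigma> \<psi>"
      using u v' \<open>run u = run v\<close> by (simp flip: L add: dfa_lang_def run_def)
    then have "word_val G \<psi> u \<otimes> inv (word_val G \<psi> v) \<in> K"
      using u v' by (simp add: word_problem_def word_val_append[OF \<psi>])
    then have "K #> (word_val G \<psi> u \<otimes> inv (word_val G \<psi> v)) = K"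
      using closed K by (simp add: coset_join2)
    then show ?thesis
      using closed subgroup.subset[OF K] coset_mult_inv1 by blast
  qed
  have "rcosets K \<subseteq> (\<lambda>q. K #> word_val G \<psi> (word q)) ` states M"
  proof
    fix C assume "C \<in> rcosets K"
    then obtain x where "x \<in> carrier G" "C = K #> x"
      by (auto simp: RCOSETS_def)
    moreover from \<open>x \<in> carrier G\<close> obtain w where "w \<in> lists \<Sigma>" "x = word_val G \<psi> w"
      unfolding surj[symmetric] by (rule imageE)
    ultimately have w: "w \<in> lists \<Sigma>" "C = K #> word_val G \<psi> w"
      by simp_all
    \<comment> \<open>The word \<open>w\<close> itself witnesses that the choice for the state
      \<open>run w\<close> succeeds.\<close>
    from w(1) have "word (run w) \<in> lists \<Sigma> \<and> run (word (run w)) = run w"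
      unfolding word_def by (metis (mono_tags, lifting) someI_ex)
    then have "C = K #> word_val G \<psi> (word (run w))"
      unfolding w(2) by (intro coset_eq w(1)) simp_all
    moreover have "run w \<in> states M"
      using w M.init by (simp add: run_def M.foldl_step_closed)
    ultimately show "C \<in> (\<lambda>q. K #> word_val G \<psi> (word q)) ` states M"
      by blast
  qed
  then show ?thesis
    unfolding finite_index_def using M.finite_states finite_surj by blast
qed

end

theorem proposition2p5:
  fixes G :: "('g, 'm) monoid_scheme" and K :: "'g set"
    and \<Sigma> :: "'a set" and \<psi> :: "'a \<Rightarrow> 'g"
  assumes "group G" and "finitely_generated G"
    and "subgroup K G"
    and "semigroup_presentation G \<Sigma> \<psi>"
  shows "regular \<Sigma> (word_problem G K \<Sigma> \<psi>) \<longleftrightarrow> finite_index G K"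
proof -
  interpret group G by fact
  have "\<psi> \<in> \<Sigma> \<rightarrow> carrier G" "word_val G \<psi> ` lists \<Sigma> = carrier G"
    using assms(4) by (auto simp only: semigroup_presentation_def)
  then show ?thesis
    using regular_word_problem_if_finite_index[OF assms(3)]
      finite_index_if_regular_word_problem[OF assms(3)] by metis
qed

end
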